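(* For all $d \ge 2$ and $k \ge 2$, $\Delta'_d(k) \ge \frac12 \exp\!\Big(\frac{k^{1/(d-1)}}{4d-4}\Big)$ and $\Delta_d(k) \ge \frac12\exp\!\Big(\frac{k^{1/(d-1)}}{4d}\Big)$.
   Context: For $x\in\mathbb{R}^d$, $\pi_1(x)=x_1$, $\pi(x)=(x_1,\dots,x_{d-1})$, $h(x)=x_d$. Regular: a finite $P\subset\mathbb{R}^d$ is regular if (R1) its projection to each coordinate axis is injective, (R2) any $d$ distinct points of $\pi(P)$ are affinely independent, (R3) for all disjoint nonempty $S,T\subset P$ with $|S|+|T|=d+1$ (a generic pair), $|\operatorname{span}(\pi(S))\cap\operatorname{span}(\pi(T))|=1$ (affine spans). For a generic pair, $S$ lies above $T$ if the unique $(s,t)\in\operatorname{span}(S)\times\operatorname{span}(T)$ with $\pi(s)=\pi(t)$ has $h(s)>h(t)$; $A$ is high above $B$ if $A\cup B$ is regular and $S$ lies above $T$ for all generic pairs with $S\subseteq A$, $T\subseteq B$. For $Q=\{q_1,\dots,q_m\}$ with $\pi_1(q_1)<\dots<\pi_1(q_m)$, $Q_{a,b}=\{q_t: t\equiv a\pmod b\}$. $d$-oscillators: any finite $P\subset\mathbb{R}^d$ with $|P|=1$ or $d=1$ is one; for $|P|\ge2$, $d\ge2$, $P$ is one if it is regular, $P_{1,2}$ and $P_{2,2}$ are $d$-oscillators, one of $P_{1,2},P_{2,2}$ is high above the other, and $\pi(P)$ is a $(d-1)$-oscillator. A regular $P$ is a convex cup (resp. cap) if for all $p,p_1,\dots,p_d\in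 P$ and $c_i\in(0,1)$ with $\sum c_i=1$, $\pi(p)=\sum c_i\pi(p_i)$ implies $h(p)<\sum c_ih(p_i)$ (resp. $>$). A set is convex independent if no $d+1$ of its points lie on a hyperplane and its points are the vertices of a convex polytope. For a $d$-oscillator $P=\{p_1,\dots,p_m\}$ (indexed by increasing first coordinate) and nonempty $C=\{p_{i_1},\dots,p_{i_k}\}\subseteq P$ with $i_1<\dots<i_k$, $\operatorname{str}_P(C)=i_k-i_1$. With $\mathcal{O}_d$ the set of all $d$-oscillators, $\mathcal{C}_k(P)$ the $k$-element convex independent subsets of $P$, and $\mathcal{C}'_k(P)$ the $k$-element subsets of $P$ that are a convex cup or cap: $\Delta_d(k)=\min_{P\in\mathcal{O}_d}\min_{C\in\mathcal{C}_k(P)}\operatorname{str}_P(C)$, $\Delta'_d(k)=\min_{P\in\mathcal{O}_d}\min_{C\in\mathcal{C}'_k(P)}\operatorname{str}_P(C)$, with minimum over the empty set equal to $+\infty$. *)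

theory Defs
  imports "HOL-Analysis.Analysis" "HOL-Analysis.Finite_Function_Topology"
begin

text \<open>
  The dimension varies inside the recursive definition of oscillators, so the points of all the
  spaces \<open>\<real>\<^sup>d\<close> live in one real vector space, the finitely supported sequences; \<open>\<real>\<^sup>d\<close> is the subspace
  of those supported on \<open>{..<d}\<close>.  Coordinates are numbered from 0: the mathematical coordinate
  \<open>x\<^sub>i\<close> is \<open>lookup x (i - 1)\<close>.
\<close>

type_synonym point = "nat \<Rightarrow>\<^sub>0 real"

definition Rspace :: "nat \<Rightarrow> point set" where
  "Rspace d = {x. Poly_Mapping.keys x \<subseteq> {..<d}}"

definition first_coord :: "point \<Rightarrow> real" where
  "first_coord x = Poly_Mapping.lookup x 0"

definition height :: "nat \<Rightarrow> point \<Rightarrow> real" where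
  "height d x = Poly_Mapping.lookup x (d - 1)"

lift_definition proj :: "nat \<Rightarrow> point \<Rightarrow> point" is
  "\<lambda>d x i. if i < d - 1 then x i else 0"
  by (rule finite_subset[of _ "{..<d - 1}" for d]) auto

definition generic_pair :: "nat \<Rightarrow> point set \<Rightarrow> point set \<Rightarrow> bool" where
  "generic_pair d S T \<longleftrightarrow> finite S \<and> finite T \<and> S \<noteq> {} \<and> T \<noteq> {} \<and> S \<inter> T = {} \<and>
     card S + card T = d + 1"

definition regular :: "nat \<Rightarrow> point set \<Rightarrow> bool" where
  "regular d P \<longleftrightarrow> finite P \<and> P \<subseteq> Rspace d \<and>
     (\<forall>i<d. inj_on (\<lambda>x. Poly_Mapping.lookup x i) P) \<and>
     (\<forall>A \<subseteq> proj d ` P. card A = d \<longrightarrow> \<not> affine_dependent A) \<and>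
     (\<forall>S T. S \<subseteq> P \<and> T \<subseteq> P \<and> generic_pair d S T \<longrightarrow>
        card (affine hull (proj d ` S) \<inter> affine hull (proj d ` T)) = 1)"

text \<open>
  For a generic pair contained in a regular set the set of pairs below is a singleton; the set
  equation says that \<open>(s, t)\<close> is its unique element.
\<close>

definition lies_above :: "nat \<Rightarrow> point set \<Rightarrow> point set \<Rightarrow> bool" where
  "lies_above d S T \<longleftrightarrow>
     (\<exists>s t. {(u, v). u \<in> affine hull S \<and> v \<in> affine hull T \<and> proj d u = proj d v} = {(s, t)} \<and>
        height d s > height d t)"

definition high_above :: "nat \<Rightarrow> point set \<Rightarrow> point set \<Rightarrow> bool" where
  "high_above d A B \<longleftrightarrow> regular d (A \<union> B) \<and>
     (\<forall>S T. S \<subseteq> A \<and> T \<subseteq> B \<and> generic_pair d S T \<longrightarrow> lies_above d S T)"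

text \<open>
  If \<open>Q = {q\<^sub>1, \<dots>, q\<^sub>m}\<close> is listed by increasing first coordinate, then \<open>index_in Q q\<^sub>t = t\<close>, and
  \<open>residue_part Q a b\<close> is \<open>Q\<close> restricted to the indices congruent to \<open>a\<close> modulo \<open>b\<close>.
\<close>

definition index_in :: "point set \<Rightarrow> point \<Rightarrow> nat" where
  "index_in Q q = card {x \<in> Q. first_coord x \<le> first_coord q}"

definition residue_part :: "point set \<Rightarrow> nat \<Rightarrow> nat \<Rightarrow> point set" where
  "residue_part Q a b = {q \<in> Q. index_in Q q mod b = a mod b}"

inductive oscillator :: "nat \<Rightarrow> point set \<Rightarrow> bool" where
  single: "d \<ge> 1 \<Longrightarrow> P \<subseteq> Rspace d \<Longrightarrow> card P = 1 \<Longrightarrow> oscillator d P"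
| line: "finite P \<Longrightarrow> P \<subseteq> Rspace 1 \<Longrightarrow> oscillator 1 P"
| step: "d \<ge> 2 \<Longrightarrow> card P \<ge> 2 \<Longrightarrow> regular d P \<Longrightarrow>
    oscillator d (residue_part P 1 2) \<Longrightarrow> oscillator d (residue_part P 2 2) \<Longrightarrow>
    high_above d (residue_part P 1 2) (residue_part P 2 2) \<or>
      high_above d (residue_part P 2 2) (residue_part P 1 2) \<Longrightarrow>
    oscillator (d - 1) (proj d ` P) \<Longrightarrow> oscillator d P"

text \<open>
  The points \<open>p, p\<^sub>1, \<dots>, p\<^sub>d\<close> are meant to be distinct: with \<open>p\<^sub>1 = \<dots> = p\<^sub>d = p\<close> the required strict
  inequality would read \<open>h p < h p\<close>, and for \<open>d \<ge> 2\<close> no nonempty set would be a cup or a cap.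
\<close>

definition convex_cup :: "nat \<Rightarrow> point set \<Rightarrow> bool" where
  "convex_cup d P \<longleftrightarrow> regular d P \<and>
     (\<forall>p\<in>P. \<forall>q :: nat \<Rightarrow> point. \<forall>c :: nat \<Rightarrow> real.
        q ` {1..d} \<subseteq> P \<and> inj_on q {1..d} \<and> p \<notin> q ` {1..d} \<and>
        (\<forall>i\<in>{1..d}. 0 < c i \<and> c i < 1) \<and> (\<Sum>i=1..d. c i) = 1 \<and>
        proj d p = (\<Sum>i=1..d. c i *\<^sub>R proj d (q i)) \<longrightarrow>
        height d p < (\<Sum>i=1..d. c i * height d (q i)))"

definition convex_cap :: "nat \<Rightarrow> point set \<Rightarrow> bool" where
  "convex_cap d P \<longleftrightarrow> regular d P \<and>
     (\<forall>p\<in>P. \<forall>q :: nat \<Rightarrow> point. \<forall>c :: nat \<Rightarrow> real.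
        q ` {1..d} \<subseteq> P \<and> inj_on q {1..d} \<and> p \<notin> q ` {1..d} \<and>
        (\<forall>i\<in>{1..d}. 0 < c i \<and> c i < 1) \<and> (\<Sum>i=1..d. c i) = 1 \<and>
        proj d p = (\<Sum>i=1..d. c i *\<^sub>R proj d (q i)) \<longrightarrow>
        height d p > (\<Sum>i=1..d. c i * height d (q i)))"

definition hyperplane :: "nat \<Rightarrow> point set \<Rightarrow> bool" where
  "hyperplane d H \<longleftrightarrow>
     (\<exists>(a :: nat \<Rightarrow> real) b. (\<exists>i<d. a i \<noteq> 0) \<and>
        H = {x \<in> Rspace d. (\<Sum>i<d. a i * Poly_Mapping.lookup x i) = b})"

definition convex_independent :: "nat \<Rightarrow> point set \<Rightarrow> bool" where
  "convex_independent d C \<longleftrightarrow> C \<subseteq> Rspace d \<and>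
     \<not> (\<exists>A \<subseteq> C. card A = d + 1 \<and> (\<exists>H. hyperplane d H \<and> A \<subseteq> H)) \<and>
     (\<exists>K. polytope K \<and> C = {v. v extreme_point_of K})"

definition str :: "point set \<Rightarrow> point set \<Rightarrow> nat" where
  "str P C = Max (index_in P ` C) - Min (index_in P ` C)"

definition convex_independent_subsets :: "nat \<Rightarrow> nat \<Rightarrow> point set \<Rightarrow> point set set" where
  "convex_independent_subsets d k P = {C. C \<subseteq> P \<and> card C = k \<and> convex_independent d C}"

definition cup_cap_subsets :: "nat \<Rightarrow> nat \<Rightarrow> point set \<Rightarrow> point set set" where
  "cup_cap_subsets d k P = {C. C \<subseteq> P \<and> card C = k \<and> (convex_cup d C \<or> convex_cap d C)}"

text \<open>
  In \<^typ>\<open>enat\<close> the infimum of a nonempty set is its minimum and the infimum of the empty set is \<open>\<infinity>\<close>.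
\<close>

definition Delta :: "nat \<Rightarrow> nat \<Rightarrow> enat" where
  "Delta d k =
     (INF P\<in>{P. oscillator d P}. INF C\<in>convex_independent_subsets d k P. enat (str P C))"

definition Delta' :: "nat \<Rightarrow> nat \<Rightarrow> enat" where
  "Delta' d k =
     (INF P\<in>{P. oscillator d P}. INF C\<in>cup_cap_subsets d k P. enat (str P C))"

end

theory Submission
  imports Defs
begin

text \<open>
  Let \<open>A\<close> and \<open>B\<close> be the two halves of a \<open>d\<close>-oscillator, with \<open>A\<close> high above \<open>B\<close>, and let \<open>C\<close> be a
  convex cup of stretch at most \<open>m\<close> that meets both.  If the projection of some \<open>p \<in> C \<inter> A\<close> were in the
  convex hull of the projections of the other points of \<open>C \<inter> A\<close>, then for \<open>b \<in> C \<inter> B\<close> the ray from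
  \<open>proj b\<close> through \<open>proj p\<close> would leave that hull after \<open>proj p\<close>, so \<open>proj p\<close> would lie in a simplex
  spanned by \<open>proj b\<close> and projected points of \<open>C \<inter> A\<close>; there the cup condition contradicts that \<open>A\<close>
  is high above \<open>B\<close>.  So \<open>C \<inter> A\<close> projects to a convexly independent subset of a
  \<open>(d - 1)\<close>-oscillator, and both \<open>C \<inter> A\<close> and \<open>C \<inter> B\<close> have stretch at most \<open>m / 2\<close> in their halves.
  Caps are symmetric, and a convexly independent set is the union of a cup and a cap.  Writing \<open>K\<^sub>d(m)\<close>
  for the largest size of a cup or cap of stretch at most \<open>m\<close>, with \<open>K\<^sub>1 = 1\<close> because at most two
  points of a line are convexly independent, this gives
  \<open>K\<^sub>d(m) \<le> 2 K\<^bsub>d-1\<^esub>(m / 2) + K\<^sub>d(m / 2)\<close> and hence \<open>K\<^sub>d(m) \<le> (4 (d - 1) ln (2 m))\<^bsup>d-1\<^esup>\<close>.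
\<close>

subsection \<open>Exchanging points in convex combinations\<close>

text \<open>Unlike \<open>convex_independent\<close>, this mentions neither a dimension nor
  hyperplanes, so it can be asked of a set and of its projection alike.\<close>

definition convexly_independent :: "'a::real_vector set \<Rightarrow> bool" where
  "convexly_independent C \<longleftrightarrow> (\<forall>x\<in>C. x \<notin> convex hull (C - {x}))"

text \<open>The ratio test of the simplex method: the affine coefficients of \<open>y\<close> over
  \<open>T\<close> sum to 1, so one of them is positive, and weight can be shifted to
  \<open>y\<close> until a first coefficient, that of \<open>z\<close>, reaches zero.\<close>

lemma exchange_into_convex_hull:
  fixes F :: "'a::real_vector set"
  assumes F: "finite F" and pos: "\<And>x. x \<in> F \<Longrightarrow> c x > 0" and sum1: "sum c F = 1"
    and T: "T \<subseteq> F" and y: "y \<in> affine hull T"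
  shows "\<exists>z\<in>T. (\<Sum>x\<in>F. c x *\<^sub>R x) \<in> convex hull (insert y (F - {z}))"
proof -
  have finT: "finite T" using F T finite_subset by blast
  obtain e where e1: "sum e T = 1" and ey: "(\<Sum>x\<in>T. e x *\<^sub>R x) = y"
    using y affine_hull_finite[OF finT] by auto
  obtain t where t: "t \<in> T" "e t > 0"
    using e1 sum_nonpos[of T e] by (metis not_le not_one_le_zero)
  \<comment> \<open>\<open>1 / \<rho>\<close> is the least ratio \<open>c x / e x\<close> with
    \<open>e x > 0\<close>, hence the largest weight of \<open>y\<close> that keeps every
    \<open>g x\<close> below nonnegative.\<close>
  define \<rho> where "\<rho> = Max ((\<lambda>x. e x / c x) ` T)"
  have max: "e x / c x \<le> \<rho>" if "x \<in> T" for x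
    unfolding \<rho>_def using that finT by auto
  have "\<rho> \<in> (\<lambda>x. e x / c x) ` T"
    unfolding \<rho>_def using finT t by (intro Max_in) auto
  then obtain z where z: "z \<in> T" "\<rho> = e z / c z" by auto
  have \<rho>: "\<rho> > 0"
    using max[OF t(1)] t pos[of t] T by (smt (verit) divide_pos_pos subsetD)
  define e' where "e' x = (if x \<in> T then e x else 0)" for x
  have sume': "sum e' F = 1"
    unfolding e'_def using e1 F T by (simp add: sum.inter_restrict[symmetric] Int_absorb1)
  have e'y: "(\<Sum>x\<in>F. e' x *\<^sub>R x) = y"
  proof -
    have "(\<Sum>x\<in>F. e' x *\<^sub>R x) = (\<Sum>x\<in>T. e' x *\<^sub>R x)"
      by (rule sum.mono_neutral_right[OF F T]) (auto simp: e'_def)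
    then show ?thesis using ey by (simp add: e'_def)
  qed
  define g where "g x = c x - e' x / \<rho>" for x
  have g0: "g x \<ge> 0" if "x \<in> F" for x
  proof (cases "x \<in> T")
    case True
    then show ?thesis using max[OF True] pos[OF that] \<rho>
      by (simp add: g_def e'_def field_simps)
  next
    case False
    then show ?thesis using pos[OF that] by (simp add: g_def e'_def)
  qed
  have zF: "z \<in> F" using z T by auto
  have gz: "g z = 0" using z \<rho> pos[OF zF] by (auto simp: g_def e'_def)
  have sumg: "sum g F = 1 - 1 / \<rho>"
    unfolding g_def using sume' sum1 by (simp add: sum_subtractf sum_divide_distrib[symmetric])
  have gvec: "(\<Sum>x\<in>F. g x *\<^sub>R x) = (\<Sum>x\<in>F. c x *\<^sub>R x) - (1 / \<rho>) *\<^sub>R y"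
  proof -
    have "(\<Sum>x\<in>F. g x *\<^sub>R x) = (\<Sum>x\<in>F. c x *\<^sub>R x - (1 / \<rho>) *\<^sub>R (e' x *\<^sub>R x))"
      by (rule sum.cong) (auto simp: g_def scaleR_diff_left)
    then show ?thesis using e'y by (simp add: sum_subtractf scaleR_sum_right[symmetric] del: scaleR_scaleR)
  qed
  \<comment> \<open>The slot of \<open>z\<close>, emptied by \<open>g z = 0\<close>, is reused for
    \<open>y\<close>. Summing over \<open>F\<close> stays correct even if \<open>y\<close> already
    belongs to \<open>F - {z}\<close>.\<close>
  define w where "w x = (if x = z then 1 / \<rho> else g x)" for x
  define v where "v x = (if x = z then y else x)" for x
  have split: "sum f F = f z + sum f (F - {z})" for f :: "'a \<Rightarrow> 'c::comm_monoid_add"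
    using F zF by (rule sum.remove)
  have w1: "sum w F = 1"
    using sumg gz by (simp add: split w_def)
  have "(\<Sum>x\<in>F. w x *\<^sub>R v x) = (1 / \<rho>) *\<^sub>R y + (\<Sum>x\<in>F - {z}. g x *\<^sub>R x)"
    by (simp add: split w_def v_def)
  also have "\<dots> = (\<Sum>x\<in>F. c x *\<^sub>R x)"
    using gvec gz split[of "\<lambda>x. g x *\<^sub>R x"] by (simp add: algebra_simps)
  finally have eq: "(\<Sum>x\<in>F. c x *\<^sub>R x) = (\<Sum>x\<in>F. w x *\<^sub>R v x)" by simp
  have "(\<Sum>x\<in>F. w x *\<^sub>R v x) \<in> convex hull (insert y (F - {z}))"
  proof (rule convex_sum[OF F convex_convex_hull w1])
    show "w x \<ge> 0" if "x \<in> F" for x using that g0 \<rho> by (simp add: w_def)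
    show "v x \<in> convex hull (insert y (F - {z}))" if "x \<in> F" for x
      using that by (auto simp: v_def intro: hull_inc)
  qed
  then show ?thesis using eq z by auto
qed

text \<open>A vanishing coefficient would allow its point to be dropped, against
  \<open>min\<close>.\<close>

lemma convex_hull_positive_coeffs:
  fixes F :: "'a::real_vector set"
  assumes F: "finite F" and a: "a \<in> convex hull F"
    and min: "\<And>x. x \<in> F \<Longrightarrow> a \<notin> convex hull (F - {x})"
  obtains c where "\<And>x. x \<in> F \<Longrightarrow> c x > 0" "sum c F = 1" "a = (\<Sum>x\<in>F. c x *\<^sub>R x)"
proof -
  obtain c where c: "\<forall>x\<in>F. 0 \<le> c x" "sum c F = 1" "(\<Sum>x\<in>F. c x *\<^sub>R x) = a"
    using a convex_hull_finite[OF F] by auto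
  have "c x > 0" if x: "x \<in> F" for x
  proof (rule ccontr)
    assume "\<not> c x > 0"
    then have 0: "c x = 0" using c x by force
    have "sum c (F - {x}) = 1" "(\<Sum>x\<in>F - {x}. c x *\<^sub>R x) = a"
      using c 0 by (simp_all add: sum.remove[OF F x])
    then have "a \<in> convex hull (F - {x})"
      using c(1) F by (subst convex_hull_finite) auto
    then show False using min[OF x] by simp
  qed
  then show ?thesis using c that by metis
qed

text \<open>A minimal \<open>F \<subseteq> X - {a}\<close> with \<open>a\<close> in its convex hull has \<open>d\<close> points, hence affinely spans \<open>y\<close>,
  and so \<open>y\<close> can replace one point of \<open>F\<close>: this is where the ray from \<open>y\<close> through \<open>a\<close> leaves the
  simplex.\<close>

lemma simplex_through_outer_point:
  fixes Y :: "'a::real_vector set"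
  assumes finY: "finite Y" and cardY: "d \<le> card Y"
    and indep: "\<And>D. D \<subseteq> Y \<Longrightarrow> card D = d \<Longrightarrow> \<not> affine_dependent D"
    and span: "\<And>D x. D \<subseteq> Y \<Longrightarrow> card D = d \<Longrightarrow> x \<in> Y - D \<Longrightarrow> x \<in> affine hull D"
    and X: "X \<subseteq> Y" and y: "y \<in> Y - X" and a: "a \<in> X" "a \<in> convex hull (X - {a})"
  obtains G c where "G \<subseteq> insert y (X - {a})" "y \<in> G" "card G = d"
    "\<And>x. x \<in> G \<Longrightarrow> c x > 0" "sum c G = 1" "a = (\<Sum>x\<in>G. c x *\<^sub>R x)"
proof -
  \<comment> \<open>A set of at most \<open>d\<close> points of \<open>Y\<close> extends to one of
    exactly \<open>d\<close> points, and affine independence passes to subsets.\<close>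
  have small: "\<not> affine_dependent D" if "D \<subseteq> Y" "card D \<le> d" for D
    using exists_subset_between[OF that(2) cardY that(1) finY] indep affine_independent_subset
    by metis
  have notin: "a \<notin> convex hull D" if "D \<subseteq> Y" "a \<notin> D" "card D < d" for D
  proof
    assume "a \<in> convex hull D"
    then have "a \<in> affine hull (insert a D - {a})"
      using convex_hull_subset_affine_hull that(2) by auto
    then have "affine_dependent (insert a D)" unfolding affine_dependent_def by blast
    moreover have "finite D" using that finY finite_subset by blast
    ultimately show False using small[of "insert a D"] that a X by auto
  qed
  obtain F where F: "F \<subseteq> X - {a}" "a \<in> convex hull F"
    and least: "\<And>E. E \<subseteq> X - {a} \<Longrightarrow> a \<in> convex hull E \<Longrightarrow> card F \<le> card E"
    using ex_has_least_nat[of "\<lambda>F. F \<subseteq> X - {a} \<and> a \<in> convex hull F" "X - {a}" card] a by auto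
  have finF: "finite F" using F X finY by (meson Diff_subset finite_subset order_trans)
  have min: "a \<notin> convex hull (F - {x})" if "x \<in> F" for x
    using least[of "F - {x}"] that F finF card_Diff1_less[OF finF that] by auto
  obtain c where c: "\<And>x. x \<in> F \<Longrightarrow> c x > 0" "sum c F = 1" "a = (\<Sum>x\<in>F. c x *\<^sub>R x)"
    using convex_hull_positive_coeffs[OF finF F(2) min] by metis
  \<comment> \<open>With more than \<open>d\<close> points, some \<open>w\<close> in
    \<open>F\<close> lies in the affine hull of \<open>d\<close> others. Exchanging it in removes
    \<open>z\<close> and adds nothing new, against the minimality of \<open>F\<close>.\<close>
  have "\<not> d < card F"
  proof
    assume less: "d < card F"
    obtain T where T: "T \<subseteq> F" "card T = d" using less by (meson less_imp_le obtain_subset_with_card_n)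
    then obtain w where w: "w \<in> F" "w \<notin> T" 
      by (metis less_irrefl subsetI subset_antisym less)
    have "w \<in> affine hull T"
      using span[of T w] T w F X by auto
    then obtain z where z: "z \<in> T" "a \<in> convex hull (insert w (F - {z}))"
      using exchange_into_convex_hull[OF finF c(1,2) T(1)] c(3) by auto
    moreover have "insert w (F - {z}) = F - {z}" using w z by auto
    ultimately show False using min[of z] T by auto
  qed
  moreover have "\<not> card F < d" using notin[of F] F X by auto
  ultimately have cF: "card F = d" by simp
  have "y \<in> affine hull F" using span[of F y] cF F X y by auto
  then obtain z where z: "z \<in> F" "a \<in> convex hull (insert y (F - {z}))"
    using exchange_into_convex_hull[OF finF c(1,2) subset_refl] c(3) by auto
  define G where "G = insert y (F - {z})"
  have "y \<notin> F" using y F by auto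
  then have cG: "card G = d" 
    unfolding G_def using z cF finF by (metis Diff_iff card.insert card.remove finite_Diff)
  have finG: "finite G" using finF G_def by simp
  have "a \<notin> G" using F y a by (auto simp: G_def)
  \<comment> \<open>Dropping a point of \<open>G\<close> leaves fewer than \<open>d\<close> points,
    too few to have \<open>a\<close> in their hull. Hence all coefficients over \<open>G\<close>,
    that of \<open>y\<close> included, are positive.\<close>
  have "a \<notin> convex hull (G - {x})" if "x \<in> G" for x
    using \<open>a \<notin> G\<close> that cG F X y card_Diff1_less[OF finG that] by (intro notin) (auto simp: G_def)
  then obtain u where "\<And>x. x \<in> G \<Longrightarrow> u x > 0" "sum u G = 1" "a = (\<Sum>x\<in>G. u x *\<^sub>R x)"
    using convex_hull_positive_coeffs[OF finG] z(2) G_def by metis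
  moreover have "G \<subseteq> insert y (X - {a})" using F by (auto simp: G_def)
  ultimately show ?thesis using that[of G u] cG by (auto simp: G_def)
qed

subsection \<open>Cups and caps in regular sets\<close>

lemma lookup_scaleR [simp]: "Poly_Mapping.lookup (r *\<^sub>R (x :: 'a \<Rightarrow>\<^sub>0 'b::real_vector)) i = r *\<^sub>R Poly_Mapping.lookup x i"
proof -
  have "finite {i. r *\<^sub>R Poly_Mapping.lookup x i \<noteq> 0}"
    by (rule finite_subset[OF _ finite_lookup[of x]]) auto
  then show ?thesis unfolding scaleR_poly_mapping_def by (simp add: Abs_poly_mapping_inverse)
qed

lemma lookup_proj: "Poly_Mapping.lookup (proj d x) i = (if i < d - 1 then Poly_Mapping.lookup x i else 0)"
  by transfer simp

lemma linear_proj: "linear (proj d)"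
  by (rule linearI; rule poly_mapping_eqI) (simp_all add: lookup_proj lookup_add)

lemma linear_height: "linear (height d)"
  by (rule linearI) (simp_all add: height_def lookup_add)

lemma regularD:
  assumes "regular d P"
  shows "finite P" "P \<subseteq> Rspace d" "\<And>i. i < d \<Longrightarrow> inj_on (\<lambda>x. Poly_Mapping.lookup x i) P"
    "\<And>A. A \<subseteq> proj d ` P \<Longrightarrow> card A = d \<Longrightarrow> \<not> affine_dependent A"
    "\<And>S T. S \<subseteq> P \<Longrightarrow> T \<subseteq> P \<Longrightarrow> generic_pair d S T \<Longrightarrow>
       card (affine hull (proj d ` S) \<inter> affine hull (proj d ` T)) = 1"
  using assms unfolding regular_def by simp_all

lemma regular_subset:
  assumes P: "regular d P" and C: "C \<subseteq> P"
  shows "regular d C"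
  unfolding regular_def
proof (intro conjI allI impI)
  show "finite C" "C \<subseteq> Rspace d" using regularD(1,2)[OF P] C finite_subset by auto
  show "inj_on (\<lambda>x. Poly_Mapping.lookup x i) C" if "i < d" for i
    using inj_on_subset[OF regularD(3)[OF P that] C] .
  show "\<not> affine_dependent A" if "A \<subseteq> proj d ` C" "card A = d" for A
    using regularD(4)[OF P _ that(2)] that(1) image_mono[OF C, of "proj d"] by (metis order_trans)
  show "card (affine hull (proj d ` S) \<inter> affine hull (proj d ` T)) = 1"
    if "S \<subseteq> C \<and> T \<subseteq> C \<and> generic_pair d S T" for S T
    using regularD(5)[OF P, of S T] C that by (metis order_trans)
qed

lemma convex_cup_subset:
  assumes C: "convex_cup d C" and D: "D \<subseteq> C"
  shows "convex_cup d D"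
  unfolding convex_cup_def
proof (intro conjI ballI allI impI)
  show "regular d D" using regular_subset[OF _ D] C unfolding convex_cup_def by simp
  fix p q and c :: "nat \<Rightarrow> real"
  assume "p \<in> D" "q ` {1..d} \<subseteq> D \<and> inj_on q {1..d} \<and> p \<notin> q ` {1..d} \<and>
    (\<forall>i\<in>{1..d}. 0 < c i \<and> c i < 1) \<and> (\<Sum>i=1..d. c i) = 1 \<and>
    proj d p = (\<Sum>i=1..d. c i *\<^sub>R proj d (q i))"
  then show "height d p < (\<Sum>i=1..d. c i * height d (q i))"
    using C D unfolding convex_cup_def
    by (elim conjE) (drule bspec[of _ _ p], force, drule spec[of _ q], drule spec[of _ c], simp)
qed

lemma convex_cap_subset:
  assumes C: "convex_cap d C" and D: "D \<subseteq> C"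
  shows "convex_cap d D"
  unfolding convex_cap_def
proof (intro conjI ballI allI impI)
  show "regular d D" using regular_subset[OF _ D] C unfolding convex_cap_def by simp
  fix p q and c :: "nat \<Rightarrow> real"
  assume "p \<in> D" "q ` {1..d} \<subseteq> D \<and> inj_on q {1..d} \<and> p \<notin> q ` {1..d} \<and>
    (\<forall>i\<in>{1..d}. 0 < c i \<and> c i < 1) \<and> (\<Sum>i=1..d. c i) = 1 \<and>
    proj d p = (\<Sum>i=1..d. c i *\<^sub>R proj d (q i))"
  then show "height d p > (\<Sum>i=1..d. c i * height d (q i))"
    using C D unfolding convex_cap_def
    by (elim conjE) (drule bspec[of _ _ p], force, drule spec[of _ q], drule spec[of _ c], simp)
qed

lemma first_coord_proj: "d \<ge> 2 \<Longrightarrow> first_coord (proj d x) = first_coord x"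
  by (simp add: first_coord_def lookup_proj)

lemma inj_on_first_coord: "regular d P \<Longrightarrow> d \<ge> 2 \<Longrightarrow> inj_on first_coord P"
  unfolding first_coord_def by (simp add: regularD(3))

text \<open>The first coordinate survives the projection when \<open>d \<ge> 2\<close>, and it
  separates the points of a regular set.\<close>

lemma inj_on_proj: "regular d P \<Longrightarrow> d \<ge> 2 \<Longrightarrow> inj_on (proj d) P"
  by (rule inj_onI) (metis first_coord_proj inj_onD inj_on_first_coord)

lemma positive_coeffs_less_1:
  fixes c :: "'a \<Rightarrow> real"
  assumes "card Q \<ge> 2" "\<And>x. x \<in> Q \<Longrightarrow> 0 < c x" "sum c Q = 1" "x \<in> Q"
  shows "c x < 1"
proof -
  have fin: "finite Q" using assms(1) by (rule_tac ccontr) auto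
  have "card (Q - {x}) > 0" using assms by simp
  then have "Q - {x} \<noteq> {}" by (metis card.empty less_irrefl)
  then have "0 < sum c (Q - {x})" using fin assms by (intro sum_pos) auto
  then show ?thesis using sum.remove[OF fin assms(4), of c] assms(3) by simp
qed

text \<open>The indexed family of the definition is replaced by a set \<open>Q\<close>, enumerated
  by a bijection from \<open>{1..d}\<close>; distinctness is then built in.\<close>

lemma convex_cupD:
  assumes "convex_cup d C" "d \<ge> 2" "p \<in> C" "Q \<subseteq> C" "card Q = d" "p \<notin> Q"
    "\<And>x. x \<in> Q \<Longrightarrow> 0 < c x" "sum c Q = 1" "proj d p = (\<Sum>x\<in>Q. c x *\<^sub>R proj d x)"
  shows "height d p < (\<Sum>x\<in>Q. c x * height d x)"
proof -
  have "finite Q" using assms(2,5) by (rule_tac ccontr) auto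
  then obtain q where q: "bij_betw q {1..d} Q"
    using ex_bij_betw_nat_finite_1 assms(5) by metis
  have im: "q ` {1..d} = Q" and inj: "inj_on q {1..d}" using q by (auto simp: bij_betw_def)
  have "c x < 1" if "x \<in> Q" for x
    using positive_coeffs_less_1[of Q c x] assms that by auto
  then have "\<forall>i\<in>{1..d}. 0 < c (q i) \<and> c (q i) < 1" using im assms(7) by blast
  moreover have "(\<Sum>i=1..d. c (q i)) = 1"
    "proj d p = (\<Sum>i=1..d. c (q i) *\<^sub>R proj d (q i))"
    "(\<Sum>i=1..d. c (q i) * height d (q i)) = (\<Sum>x\<in>Q. c x * height d x)"
    using assms(8,9) sum.reindex_bij_betw[OF q, of c] sum.reindex_bij_betw[OF q, of "\<lambda>x. c x *\<^sub>R proj d x"]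
      sum.reindex_bij_betw[OF q, of "\<lambda>x. c x * height d x"] by auto
  ultimately show ?thesis
    using assms(1) im inj \<open>p \<in> C\<close> \<open>Q \<subseteq> C\<close> \<open>p \<notin> Q\<close>
    unfolding convex_cup_def
    by (elim conjE) (drule bspec, assumption, drule spec[of _ q], drule spec[of _ "\<lambda>i. c (q i)"], simp)
qed

lemma convex_capD:
  assumes "convex_cap d C" "d \<ge> 2" "p \<in> C" "Q \<subseteq> C" "card Q = d" "p \<notin> Q"
    "\<And>x. x \<in> Q \<Longrightarrow> 0 < c x" "sum c Q = 1" "proj d p = (\<Sum>x\<in>Q. c x *\<^sub>R proj d x)"
  shows "height d p > (\<Sum>x\<in>Q. c x * height d x)"
proof -
  have "finite Q" using assms(2,5) by (rule_tac ccontr) auto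
  then obtain q where q: "bij_betw q {1..d} Q"
    using ex_bij_betw_nat_finite_1 assms(5) by metis
  have im: "q ` {1..d} = Q" and inj: "inj_on q {1..d}" using q by (auto simp: bij_betw_def)
  have "c x < 1" if "x \<in> Q" for x
    using positive_coeffs_less_1[of Q c x] assms that by auto
  then have "\<forall>i\<in>{1..d}. 0 < c (q i) \<and> c (q i) < 1" using im assms(7) by blast
  moreover have "(\<Sum>i=1..d. c (q i)) = 1"
    "proj d p = (\<Sum>i=1..d. c (q i) *\<^sub>R proj d (q i))"
    "(\<Sum>i=1..d. c (q i) * height d (q i)) = (\<Sum>x\<in>Q. c x * height d x)"
    using assms(8,9) sum.reindex_bij_betw[OF q, of c] sum.reindex_bij_betw[OF q, of "\<lambda>x. c x *\<^sub>R proj d x"]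
      sum.reindex_bij_betw[OF q, of "\<lambda>x. c x * height d x"] by auto
  ultimately show ?thesis
    using assms(1) im inj \<open>p \<in> C\<close> \<open>Q \<subseteq> C\<close> \<open>p \<notin> Q\<close>
    unfolding convex_cap_def
    by (elim conjE) (drule bspec, assumption, drule spec[of _ q], drule spec[of _ "\<lambda>i. c (q i)"], simp)
qed

section \<open>Simplices in the projection of a regular set\<close>

lemma regular_affine_independent:
  "regular d C \<Longrightarrow> D \<subseteq> proj d ` C \<Longrightarrow> card D = d \<Longrightarrow> \<not> affine_dependent D"
  by (rule regularD(4))

text \<open>One point against \<open>d\<close> others is a generic pair, so (R3) makes their
  projected affine hulls meet, and the hull of one point is that point.\<close>

lemma regular_affine_span:
  assumes reg: "regular d C" and d: "d \<ge> 2" and D: "D \<subseteq> proj d ` C" "card D = d"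
    and y: "y \<in> proj d ` C - D"
  shows "y \<in> affine hull D"
proof -
  obtain T where T: "T \<subseteq> C" "proj d ` T = D" using D(1) by (auto simp: subset_image_iff)
  obtain p where p: "p \<in> C" "y = proj d p" using y by auto
  have "finite T" using T(1) regularD(1)[OF reg] finite_subset by blast
  moreover have "card T = d"
    using card_image[of "proj d" T] inj_on_subset[OF inj_on_proj[OF reg d] T(1)] T D by simp
  moreover have "p \<notin> T" using p y T by auto
  ultimately have "generic_pair d {p} T" using d unfolding generic_pair_def by auto
  then have "card (affine hull (proj d ` {p}) \<inter> affine hull (proj d ` T)) = 1"
    using p T by (intro regularD(5)[OF reg]) auto
  then have "affine hull (proj d ` {p}) \<inter> affine hull (proj d ` T) \<noteq> {}" by force
  moreover have sing: "affine hull (proj d ` {p}) = {y}"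
    unfolding p(2) by (subst hull_same) (auto simp: affine_def scaleR_left_distrib[symmetric])
  ultimately show ?thesis unfolding sing T(2) by simp
qed

text \<open>The simplex is found in the projection and pulled back along \<open>proj d\<close>,
  which is injective on \<open>C\<close>. The result is a configuration with vertex \<open>b\<close>
  to which the cup or cap inequality applies.\<close>

lemma simplex_through_outer_lift:
  assumes reg: "regular d C" and d: "d \<ge> 2" "d \<le> card C"
    and X: "X \<subseteq> C" and b: "b \<in> C - X" and nci: "\<not> convexly_independent (proj d ` X)"
  obtains p Q c where "p \<in> X" "Q \<subseteq> insert b (X - {p})" "b \<in> Q" "card Q = d"
    "\<And>x. x \<in> Q \<Longrightarrow> 0 < c x" "sum c Q = 1" "proj d p = (\<Sum>x\<in>Q. c x *\<^sub>R proj d x)"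
proof -
  have inj: "inj_on (proj d) C" using inj_on_proj[OF reg d(1)] .
  have finY: "finite (proj d ` C)" using regularD(1)[OF reg] by simp
  have cY: "d \<le> card (proj d ` C)" using d(2) card_image[OF inj] by simp
  have y: "proj d b \<in> proj d ` C - proj d ` X"
    using b X inj by (auto simp: inj_on_def)
  obtain p where p: "p \<in> X" "proj d p \<in> convex hull (proj d ` X - {proj d p})"
    using nci unfolding convexly_independent_def by auto
  obtain G c where G: "G \<subseteq> insert (proj d b) (proj d ` X - {proj d p})" "proj d b \<in> G" "card G = d"
    "\<And>x. x \<in> G \<Longrightarrow> c x > 0" "sum c G = 1" "proj d p = (\<Sum>x\<in>G. c x *\<^sub>R x)"
  proof (rule simplex_through_outer_point[OF finY cY _ _ image_mono[OF X] y imageI[OF p(1)] p(2)])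
    show "\<not> affine_dependent D" if "D \<subseteq> proj d ` C" "card D = d" for D
      using regular_affine_independent[OF reg that] .
    show "x \<in> affine hull D" if "D \<subseteq> proj d ` C" "card D = d" "x \<in> proj d ` C - D" for D x
      using regular_affine_span[OF reg d(1) that] .
  qed simp
  define Q where "Q = {x \<in> insert b X. proj d x \<in> G}"
  have QC: "Q \<subseteq> C" using X b by (auto simp: Q_def)
  have QG: "proj d ` Q = G" using G(1,2) by (auto simp: Q_def)
  have injQ: "inj_on (proj d) Q" using inj_on_subset[OF inj QC] .
  have "proj d p \<noteq> proj d b" using y imageI[OF p(1), of "proj d"] by (metis Diff_iff)
  then have "proj d p \<notin> G" using G(1) by auto
  then have "Q \<subseteq> insert b (X - {p})" by (auto simp: Q_def)
  moreover have "b \<in> Q" using G(2) by (simp add: Q_def)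
  moreover have "card Q = d" using card_image[OF injQ] QG G(3) by simp
  moreover have "sum (\<lambda>x. c (proj d x)) Q = 1"
    using sum.reindex[OF injQ, of c] QG G(5) by simp
  moreover have "proj d p = (\<Sum>x\<in>Q. c (proj d x) *\<^sub>R proj d x)"
    using sum.reindex[OF injQ, of "\<lambda>x. c x *\<^sub>R x"] QG G(6) by simp
  ultimately show ?thesis using that[of p Q "\<lambda>x. c (proj d x)"] p QG G(4) by blast
qed

section \<open>Cups and caps across two sets, one high above the other\<close>

lemma lies_aboveD:
  assumes "lies_above d S T" "u \<in> affine hull S" "v \<in> affine hull T" "proj d u = proj d v"
  shows "height d u > height d v"
proof -
  obtain s t where "{(u, v). u \<in> affine hull S \<and> v \<in> affine hull T \<and> proj d u = proj d v} = {(s, t)}"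
    "height d s > height d t" using assms(1) unfolding lies_above_def by auto
  moreover have "(u, v) \<in> {(u, v). u \<in> affine hull S \<and> v \<in> affine hull T \<and> proj d u = proj d v}"
    using assms by auto
  ultimately show ?thesis by auto
qed

text \<open>Solving \<open>proj p = \<Sum> c x proj x\<close> for the vertex \<open>b\<close> turns a point of the simplex into a point
  on the line through \<open>b\<close> and the affine hull of \<open>p\<close> and the other vertices.\<close>

lemma solve_for_vertex:
  assumes d: "d \<ge> 2" and Q: "card Q = d" "b \<in> Q" "p \<notin> Q"
    and c: "\<And>x. x \<in> Q \<Longrightarrow> 0 < c x" "sum c Q = 1" "proj d p = (\<Sum>x\<in>Q. c x *\<^sub>R proj d x)"
  obtains s where "s \<in> affine hull (insert p (Q - {b}))" "proj d s = proj d b"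
    "c b * (height d s - height d b) = height d p - (\<Sum>x\<in>Q. c x * height d x)"
proof -
  have fin: "finite Q" using d Q(1) by (rule_tac ccontr) auto
  define R where "R = Q - {b}"
  have R: "finite R" "p \<notin> R" "b \<notin> R" using fin Q by (auto simp: R_def)
  have split: "sum f Q = f b + sum f R" for f :: "point \<Rightarrow> 'c::comm_monoid_add"
    unfolding R_def using fin Q(2) by (rule sum.remove)
  have cb: "c b > 0" using c Q by auto
  define s where "s = (1 / c b) *\<^sub>R (p - (\<Sum>x\<in>R. c x *\<^sub>R x))"
  define u where "u x = (if x = p then 1 / c b else - c x / c b)" for x
  have uR: "u x = - c x / c b" if "x \<in> R" for x using that R by (auto simp: u_def)
  have "sum u (insert p R) = 1 / c b + (\<Sum>x\<in>R. - c x / c b)"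
    using R uR by (simp add: u_def[of p])
  also have "\<dots> = 1 / c b - sum c R / c b"
    by (simp add: sum_divide_distrib[symmetric] sum_negf)
  also have "\<dots> = 1" using c(2) split[of c] cb by (simp add: field_simps)
  finally have u1: "sum u (insert p R) = 1" .
  have "(\<Sum>x\<in>insert p R. u x *\<^sub>R x) = (1 / c b) *\<^sub>R p + (\<Sum>x\<in>R. (- c x / c b) *\<^sub>R x)"
    using R uR by (simp add: u_def[of p])
  also have "(\<Sum>x\<in>R. (- c x / c b) *\<^sub>R x) = (\<Sum>x\<in>R. - ((1 / c b) *\<^sub>R (c x *\<^sub>R x)))"
    by (intro sum.cong) auto
  also have "(1 / c b) *\<^sub>R p + \<dots> = s"
    by (simp add: s_def scaleR_diff_right sum_negf scaleR_sum_right)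
  finally have "(\<Sum>x\<in>insert p R. u x *\<^sub>R x) = s" .
  then have s1: "s \<in> affine hull (insert p R)"
    using u1 R by (subst affine_hull_finite) auto
  have "proj d s = (1 / c b) *\<^sub>R (proj d p - (\<Sum>x\<in>R. c x *\<^sub>R proj d x))"
    unfolding s_def by (simp add: linear_cmul[OF linear_proj] linear_diff[OF linear_proj] linear_sum[OF linear_proj])
  also have "\<dots> = proj d b" using c(3) split[of "\<lambda>x. c x *\<^sub>R proj d x"] cb by simp
  finally have s2: "proj d s = proj d b" .
  \<comment> \<open>Since \<open>c b > 0\<close>, the identity obtained says that \<open>s\<close>
    is above \<open>b\<close> exactly when \<open>p\<close> is above the point of the simplex on its
    vertical line.\<close>
  have "height d s = (1 / c b) * (height d p - (\<Sum>x\<in>R. c x * height d x))"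
    unfolding s_def by (simp add: linear_cmul[OF linear_height] linear_diff[OF linear_height] linear_sum[OF linear_height])
  then have "c b * (height d s - height d b) = height d p - (\<Sum>x\<in>Q. c x * height d x)"
    using split[of "\<lambda>x. c x * height d x"] cb by (simp add: field_simps)
  then show ?thesis using that s1 s2 R_def by blast
qed

lemma high_aboveD:
  "high_above d A B \<Longrightarrow> S \<subseteq> A \<Longrightarrow> T \<subseteq> B \<Longrightarrow> generic_pair d S T \<Longrightarrow> lies_above d S T"
  unfolding high_above_def by blast

lemma generic_pair_singleton:
  assumes "d \<ge> 2" "card Q = d" "b \<in> Q" "p \<notin> Q"
  shows "generic_pair d (insert p (Q - {b})) {b}" "generic_pair d {b} (insert p (Q - {b}))"
proof -
  have "finite Q" using assms(1,2) by (rule_tac ccontr) auto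
  then show "generic_pair d (insert p (Q - {b})) {b}"
    using assms unfolding generic_pair_def by auto
  then show "generic_pair d {b} (insert p (Q - {b}))"
    unfolding generic_pair_def by auto
qed

text \<open>Otherwise some \<open>p\<close> in \<open>A\<close> projects into a simplex with vertex
  \<open>b\<close>. Solving for \<open>b\<close> gives \<open>s\<close> over \<open>b\<close> in the
  affine hull of points of \<open>A\<close>; as \<open>A\<close> is high above \<open>B\<close>,
  \<open>s\<close> is above \<open>b\<close> and so \<open>p\<close> is above the simplex, whereas a
  cup has it below. The hypothesis \<open>d \<le> card C\<close> provides enough points for a
  simplex.\<close>

lemma cup_high_part_independent:
  assumes cup: "convex_cup d C" and d: "d \<ge> 2" "d \<le> card C"
    and high: "high_above d A B" and disj: "A \<inter> B = {}" and b: "b \<in> C \<inter> B"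
  shows "convexly_independent (proj d ` (C \<inter> A))"
proof (rule ccontr)
  assume nci: "\<not> ?thesis"
  have reg: "regular d C" using cup by (simp add: convex_cup_def)
  have "b \<in> C - C \<inter> A" using b disj by auto
  then obtain p Q c where p: "p \<in> C \<inter> A" "Q \<subseteq> insert b (C \<inter> A - {p})" "b \<in> Q" "card Q = d"
    and c: "\<And>x. x \<in> Q \<Longrightarrow> 0 < c x" "sum c Q = 1" "proj d p = (\<Sum>x\<in>Q. c x *\<^sub>R proj d x)"
    by (rule simplex_through_outer_lift[OF reg d Int_lower1 _ nci]) blast
  have pQ: "p \<notin> Q" using p b disj by auto
  obtain s where s: "s \<in> affine hull (insert p (Q - {b}))" "proj d s = proj d b"
    "c b * (height d s - height d b) = height d p - (\<Sum>x\<in>Q. c x * height d x)"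
    by (rule solve_for_vertex[OF d(1) p(4,3) pQ c]) blast
  have "lies_above d (insert p (Q - {b})) {b}"
    using p b by (intro high_aboveD[OF high] generic_pair_singleton d pQ) auto
  then have "height d s > height d b" using s by (intro lies_aboveD) (auto intro: hull_inc)
  moreover have "height d p < (\<Sum>x\<in>Q. c x * height d x)"
    using p b by (intro convex_cupD[OF cup d(1) _ _ p(4) pQ c]) auto
  ultimately show False using s(3) c(1)[OF p(3)] by (smt (verit) mult_pos_pos)
qed

text \<open>The mirror image: \<open>b\<close> now comes from the high set and \<open>s\<close> from
  the affine hull of low points, so \<open>s\<close> is below \<open>b\<close>, which puts
  \<open>p\<close> below the simplex, against the cap condition.\<close>

lemma cap_low_part_independent:
  assumes cap: "convex_cap d C" and d: "d \<ge> 2" "d \<le> card C"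
    and high: "high_above d A B" and disj: "A \<inter> B = {}" and b: "b \<in> C \<inter> A"
  shows "convexly_independent (proj d ` (C \<inter> B))"
proof (rule ccontr)
  assume nci: "\<not> ?thesis"
  have reg: "regular d C" using cap by (simp add: convex_cap_def)
  have "b \<in> C - C \<inter> B" using b disj by auto
  then obtain p Q c where p: "p \<in> C \<inter> B" "Q \<subseteq> insert b (C \<inter> B - {p})" "b \<in> Q" "card Q = d"
    and c: "\<And>x. x \<in> Q \<Longrightarrow> 0 < c x" "sum c Q = 1" "proj d p = (\<Sum>x\<in>Q. c x *\<^sub>R proj d x)"
    by (rule simplex_through_outer_lift[OF reg d Int_lower1 _ nci]) blast
  have pQ: "p \<notin> Q" using p b disj by auto
  obtain s where s: "s \<in> affine hull (insert p (Q - {b}))" "proj d s = proj d b"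
    "c b * (height d s - height d b) = height d p - (\<Sum>x\<in>Q. c x * height d x)"
    by (rule solve_for_vertex[OF d(1) p(4,3) pQ c]) blast
  have "lies_above d {b} (insert p (Q - {b}))"
    using p b by (intro high_aboveD[OF high] generic_pair_singleton d pQ) auto
  then have "height d b > height d s" using s by (intro lies_aboveD) (auto intro: hull_inc)
  moreover have "height d p > (\<Sum>x\<in>Q. c x * height d x)"
    using p b by (intro convex_capD[OF cap d(1) _ _ p(4) pQ c]) auto
  ultimately show False using s(3) c(1)[OF p(3)] by (smt (verit) mult_pos_pos mult_minus_right)
qed

section \<open>Convexly independent sets as unions of a cup and a cap\<close>

lemma convex_Rspace: "convex (Rspace d)"
proof (rule convexI)
  fix x y :: point and u v :: real
  assume "x \<in> Rspace d" "y \<in> Rspace d"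
  then have "Poly_Mapping.lookup x i = 0 \<and> Poly_Mapping.lookup y i = 0" if "\<not> i < d" for i
    using that by (auto simp: Rspace_def in_keys_iff)
  then have "Poly_Mapping.lookup (u *\<^sub>R x + v *\<^sub>R y) i = 0" if "\<not> i < d" for i
    using that by (simp add: lookup_add)
  then show "u *\<^sub>R x + v *\<^sub>R y \<in> Rspace d"
    unfolding Rspace_def using in_keys_iff by fastforce
qed

text \<open>\<open>L\<close> collects the points strictly below the hull of the others on their
  vertical line, \<open>U\<close> those strictly above; a point whose line misses that hull is in
  both. A point in neither would have hull points weakly below and weakly above it, and the segment
  joining them would pass through it.\<close>

lemma convexly_independent_cup_cap:
  assumes ci: "convexly_independent C" and reg: "regular d C" and d: "d \<ge> 2"
  obtains L U where "C = L \<union> U" "convex_cup d L" "convex_cap d U"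
proof -
  define L where "L = {p \<in> C. \<forall>y \<in> convex hull (C - {p}). proj d y = proj d p \<longrightarrow> height d y > height d p}"
  define U where "U = {p \<in> C. \<forall>y \<in> convex hull (C - {p}). proj d y = proj d p \<longrightarrow> height d y < height d p}"
  have LC: "L \<subseteq> C" "U \<subseteq> C" by (auto simp: L_def U_def)
  have hull: "(\<Sum>i=1..d. c i *\<^sub>R q i) \<in> convex hull (C - {p})"
    if "q ` {1..d} \<subseteq> C" "p \<notin> q ` {1..d}" "\<forall>i\<in>{1..d}. 0 < c i \<and> c i < 1" "(\<Sum>i=1..d. c i) = (1::real)"
    for q c p
    using that by (intro convex_sum) (auto intro!: hull_inc less_imp_le)
  have cup: "convex_cup d L"
    unfolding convex_cup_def
  proof (intro conjI ballI allI impI)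
    show "regular d L" using regular_subset[OF reg LC(1)] .
    fix p q and c :: "nat \<Rightarrow> real"
    assume "p \<in> L" "q ` {1..d} \<subseteq> L \<and> inj_on q {1..d} \<and> p \<notin> q ` {1..d} \<and>
      (\<forall>i\<in>{1..d}. 0 < c i \<and> c i < 1) \<and> (\<Sum>i=1..d. c i) = 1 \<and>
      proj d p = (\<Sum>i=1..d. c i *\<^sub>R proj d (q i))"
    then have *: "p \<in> L" "q ` {1..d} \<subseteq> L" "p \<notin> q ` {1..d}" "\<forall>i\<in>{1..d}. 0 < c i \<and> c i < 1"
      "(\<Sum>i=1..d. c i) = 1" "proj d p = (\<Sum>i=1..d. c i *\<^sub>R proj d (q i))"
      by blast+
    let ?y = "\<Sum>i=1..d. c i *\<^sub>R q i"
    have "?y \<in> convex hull (C - {p})" using * LC by (intro hull) auto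
    moreover have "proj d ?y = proj d p" using *
      by (simp add: linear_cmul[OF linear_proj] linear_sum[OF linear_proj])
    ultimately have "height d p < height d ?y" using *(1) by (auto simp: L_def)
    then show "height d p < (\<Sum>i=1..d. c i * height d (q i))"
      by (simp add: linear_cmul[OF linear_height] linear_sum[OF linear_height])
  qed
  have cap: "convex_cap d U"
    unfolding convex_cap_def
  proof (intro conjI ballI allI impI)
    show "regular d U" using regular_subset[OF reg LC(2)] .
    fix p q and c :: "nat \<Rightarrow> real"
    assume "p \<in> U" "q ` {1..d} \<subseteq> U \<and> inj_on q {1..d} \<and> p \<notin> q ` {1..d} \<and>
      (\<forall>i\<in>{1..d}. 0 < c i \<and> c i < 1) \<and> (\<Sum>i=1..d. c i) = 1 \<and>
      proj d p = (\<Sum>i=1..d. c i *\<^sub>R proj d (q i))"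
    then have *: "p \<in> U" "q ` {1..d} \<subseteq> U" "p \<notin> q ` {1..d}" "\<forall>i\<in>{1..d}. 0 < c i \<and> c i < 1"
      "(\<Sum>i=1..d. c i) = 1" "proj d p = (\<Sum>i=1..d. c i *\<^sub>R proj d (q i))"
      by blast+
    let ?y = "\<Sum>i=1..d. c i *\<^sub>R q i"
    have "?y \<in> convex hull (C - {p})" using * LC by (intro hull) auto
    moreover have "proj d ?y = proj d p" using *
      by (simp add: linear_cmul[OF linear_proj] linear_sum[OF linear_proj])
    ultimately have "height d p > height d ?y" using *(1) by (auto simp: U_def)
    then show "height d p > (\<Sum>i=1..d. c i * height d (q i))"
      by (simp add: linear_cmul[OF linear_height] linear_sum[OF linear_height])
  qed
  have "p \<in> L \<union> U" if p: "p \<in> C" for p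
  proof (rule ccontr)
    assume "p \<notin> L \<union> U"
    then obtain y z where y: "y \<in> convex hull (C - {p})" "proj d y = proj d p" "height d y \<le> height d p"
      and z: "z \<in> convex hull (C - {p})" "proj d z = proj d p" "height d z \<ge> height d p"
      using p unfolding L_def U_def by (auto simp: not_less)
    have CR: "C \<subseteq> Rspace d" using reg by (simp add: regular_def)
    have hullR: "convex hull (C - {p}) \<subseteq> Rspace d"
      using CR by (intro hull_minimal convex_Rspace) auto
    have eqI: "v = w" if "v \<in> Rspace d" "w \<in> Rspace d" "proj d v = proj d w" "height d v = height d w" for v w
    proof (rule poly_mapping_eqI)
      fix i
      consider "i < d - 1" | "i = d - 1" | "i \<ge> d" by linarith
      then show "Poly_Mapping.lookup v i = Poly_Mapping.lookup w i"
      proof cases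
        case 1
        then show ?thesis using lookup_proj[of d v i] lookup_proj[of d w i] that(3) by simp
      next
        case 2
        then show ?thesis using that(4) by (simp add: height_def)
      next
        case 3
        then have "i \<notin> Poly_Mapping.keys v" "i \<notin> Poly_Mapping.keys w"
          using that(1,2) by (auto simp: Rspace_def)
        then show ?thesis by (simp add: in_keys_iff)
      qed
    qed
    \<comment> \<open>The segment from \<open>y\<close> to \<open>z\<close> is cut at the height of
      \<open>p\<close>. If \<open>y\<close> and \<open>z\<close> have equal height, this is already
      the height of \<open>p\<close>, and \<open>t = 0\<close> serves.\<close>
    obtain t where t: "0 \<le> t" "t \<le> 1" "(1 - t) * height d y + t * height d z = height d p"
    proof (cases "height d z = height d y")
      case True
      then show ?thesis using that[of 0] y z by auto
    next
      case False
      define t where "t = (height d p - height d y) / (height d z - height d y)"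
      have pos: "height d z - height d y > 0" using False y z by auto
      then have "t * (height d z - height d y) = height d p - height d y" by (simp add: t_def)
      then have "(1 - t) * height d y + t * height d z = height d p" by (simp add: algebra_simps)
      moreover have "0 \<le> t" "t \<le> 1" using pos y z by (auto simp: t_def)
      ultimately show ?thesis using that by blast
    qed
    let ?w = "(1 - t) *\<^sub>R y + t *\<^sub>R z"
    have w: "?w \<in> convex hull (C - {p})"
      using y z t by (intro convexD[OF convex_convex_hull]) auto
    have "proj d ?w = proj d p"
      using y z by (simp add: linear_add[OF linear_proj] linear_cmul[OF linear_proj] scaleR_left_distrib[symmetric])
    moreover have "height d ?w = height d p"
      using t by (simp add: linear_add[OF linear_height] linear_cmul[OF linear_height])
    ultimately have "?w = p" using eqI[of ?w p] w hullR p CR by blast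
    then show False using w ci p unfolding convexly_independent_def by auto
  qed
  then have "C = L \<union> U" using LC by auto
  then show ?thesis using that cup cap by blast
qed

text \<open>Removing an extreme point from \<open>K\<close> leaves a convex set that contains the
  other extreme points, hence their hull.\<close>

lemma convex_independent_imp_convexly_independent:
  assumes "convex_independent d C"
  shows "convexly_independent C"
proof -
  obtain K where K: "polytope K" "C = {v. v extreme_point_of K}"
    using assms unfolding convex_independent_def by auto
  have convK: "convex K" using K(1) unfolding polytope_def by auto
  have "x \<notin> convex hull (C - {x})" if "x \<in> C" for x
  proof -
    have "C \<subseteq> K" using K(2) by (auto simp: extreme_point_of_def)
    moreover have "convex (K - {x})"
      using that K(2) extreme_point_of_stillconvex[OF convK] by auto
    ultimately have "convex hull (C - {x}) \<subseteq> K - {x}"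
      by (intro hull_minimal) auto
    then show ?thesis by auto
  qed
  then show ?thesis unfolding convexly_independent_def by blast
qed

text \<open>The base of the induction on the dimension: of three points on a line, the middle one is
  a convex combination of the outer two.\<close>

lemma convexly_independent_line:
  assumes ci: "convexly_independent C" and C: "C \<subseteq> Rspace 1"
  shows "card C \<le> 2"
proof (rule ccontr)
  assume "\<not> card C \<le> 2"
  then obtain D where D: "D \<subseteq> C" "card D = 3"
    using obtain_subset_with_card_n[of 3 C] by auto
  let ?f = "\<lambda>x :: point. Poly_Mapping.lookup x 0"
  have eqI: "x = y" if "x \<in> Rspace 1" "y \<in> Rspace 1" "?f x = ?f y" for x y
  proof (rule poly_mapping_eqI)
    fix i
    show "Poly_Mapping.lookup x i = Poly_Mapping.lookup y i"
    proof (cases "i = 0")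
      case False
      then have "i \<notin> Poly_Mapping.keys x" "i \<notin> Poly_Mapping.keys y"
        using that(1,2) by (auto simp: Rspace_def)
      then show ?thesis by (simp add: in_keys_iff)
    qed (use that in simp)
  qed
  have no: False if xyz: "x \<in> C" "y \<in> C" "z \<in> C" "?f x < ?f y" "?f y < ?f z" for x y z
  proof -
    define t where "t = (?f y - ?f x) / (?f z - ?f x)"
    have t: "0 \<le> t" "t \<le> 1" using xyz by (auto simp: t_def)
    have "t * (?f z - ?f x) = ?f y - ?f x" using xyz by (simp add: t_def)
    then have ft: "?f ((1 - t) *\<^sub>R x + t *\<^sub>R z) = ?f y"
      by (simp only: lookup_add lookup_scaleR) (simp add: algebra_simps)
    have "(1 - t) *\<^sub>R x + t *\<^sub>R z \<in> Rspace 1"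
      using t xyz C by (intro convexD[OF convex_Rspace]) auto
    then have "y = (1 - t) *\<^sub>R x + t *\<^sub>R z" using eqI ft xyz C by (metis subsetD)
    moreover have "(1 - t) *\<^sub>R x + t *\<^sub>R z \<in> convex hull (C - {y})"
      using xyz t by (intro convexD[OF convex_convex_hull]) (auto intro!: hull_inc)
    ultimately show False using ci xyz unfolding convexly_independent_def by auto
  qed
  obtain x y z where xyz: "D = {x, y, z}" "x \<noteq> y" "y \<noteq> z" "x \<noteq> z"
    using D(2) by (auto simp: card_3_iff)
  have "?f x \<noteq> ?f y" "?f y \<noteq> ?f z" "?f x \<noteq> ?f z"
    using eqI xyz D C by (metis insertCI subsetD)+
  moreover have "x \<in> C" "y \<in> C" "z \<in> C" using xyz D by auto
  ultimately show False using no by (metis linorder_neqE)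
qed

subsection \<open>Stretch in oscillators\<close>

lemma index_in_mono:
  "finite P \<Longrightarrow> first_coord x \<le> first_coord y \<Longrightarrow> index_in P x \<le> index_in P y"
  unfolding index_in_def by (intro card_mono) auto

lemma index_in_strict_mono:
  assumes "finite P" "y \<in> P" "first_coord x < first_coord y"
  shows "index_in P x < index_in P y"
  unfolding index_in_def
proof (rule psubset_card_mono)
  have "y \<in> {z \<in> P. first_coord z \<le> first_coord y} - {z \<in> P. first_coord z \<le> first_coord x}"
    using assms by simp
  then show "{z \<in> P. first_coord z \<le> first_coord x} \<subset> {z \<in> P. first_coord z \<le> first_coord y}"
    using assms(3) by fastforce
qed (use assms in simp)

lemma inj_on_index_in:
  assumes "finite P" "inj_on first_coord P"
  shows "inj_on (index_in P) P"
proof (rule inj_onI)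
  fix x y assume xy: "x \<in> P" "y \<in> P" "index_in P x = index_in P y"
  then have "first_coord x = first_coord y"
    using index_in_strict_mono[OF assms(1), of y x] index_in_strict_mono[OF assms(1), of x y]
    by (metis less_irrefl linorder_neqE)
  then show "x = y" using assms(2) xy by (meson inj_onD)
qed

lemma str_mono:
  assumes "finite C" "D \<subseteq> C" "D \<noteq> {}"
  shows "str P D \<le> str P C"
proof -
  have "Max (index_in P ` D) \<le> Max (index_in P ` C)" using assms by (intro Max_mono) auto
  moreover have "Min (index_in P ` C) \<le> Min (index_in P ` D)" using assms by (intro Min_antimono) auto
  ultimately show ?thesis unfolding str_def by linarith
qed

lemma index_in_diff_le_str:
  assumes "finite C" "x \<in> C" "y \<in> C"
  shows "index_in P y - index_in P x \<le> str P C"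
proof -
  have "index_in P y \<le> Max (index_in P ` C)" "Min (index_in P ` C) \<le> index_in P x"
    using assms by auto
  then show ?thesis unfolding str_def by linarith
qed

text \<open>The indices of \<open>C\<close> are distinct integers between their minimum and maximum,
  an interval with \<open>str P C + 1\<close> elements.\<close>

lemma card_le_str:
  assumes P: "finite P" "inj_on first_coord P" and C: "C \<subseteq> P"
  shows "card C \<le> str P C + 1"
proof (cases "C = {}")
  case False
  have fin: "finite C" using P(1) C finite_subset by blast
  have "card C = card (index_in P ` C)"
    using card_image[OF inj_on_subset[OF inj_on_index_in[OF P] C]] by simp
  also have "\<dots> \<le> card {Min (index_in P ` C)..Max (index_in P ` C)}"
    using fin by (intro card_mono) auto
  also have "\<dots> \<le> str P C + 1" unfolding str_def by simp
  finally show ?thesis .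
qed simp

lemma residue_part_subset: "residue_part P a b \<subseteq> P"
  unfolding residue_part_def by auto

lemma residue_part_2_cover: "residue_part P 1 2 \<union> residue_part P 2 2 = P"
  unfolding residue_part_def by auto

lemma residue_part_2_disjoint: "residue_part P 1 2 \<inter> residue_part P 2 2 = {}"
  unfolding residue_part_def by auto

text \<open>This is the source of the halving of the stretch: the points of the part after
  \<open>x\<close> and up to \<open>y\<close> have indices in \<open>P\<close> exceeding that of
  \<open>x\<close> by distinct positive even numbers.\<close>

lemma index_in_residue_part:
  assumes P: "finite P" "inj_on first_coord P"
    and xy: "x \<in> residue_part P a 2" "y \<in> residue_part P a 2"
  shows "2 * (index_in (residue_part P a 2) y - index_in (residue_part P a 2) x)
    \<le> index_in P y - index_in P x"
proof (cases "first_coord x \<le> first_coord y")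
  \<comment> \<open>With \<open>y\<close> before \<open>x\<close>, the truncated difference on the
    left is 0.\<close>
  case False
  then have "index_in (residue_part P a 2) y \<le> index_in (residue_part P a 2) x"
    using finite_subset[OF residue_part_subset P(1)] by (intro index_in_mono) auto
  then show ?thesis by simp
next
  case True
  let ?R = "residue_part P a 2"
  have finR: "finite ?R" using finite_subset[OF residue_part_subset P(1)] .
  define S where "S = {z \<in> ?R. first_coord x < first_coord z \<and> first_coord z \<le> first_coord y}"
  have S_diff: "S = {z \<in> ?R. first_coord z \<le> first_coord y} - {z \<in> ?R. first_coord z \<le> first_coord x}"
    by (auto simp: S_def)
  have cS: "card S = index_in ?R y - index_in ?R x"
    unfolding index_in_def S_diff using True finR by (intro card_Diff_subset) auto
  define f where "f z = (index_in P z - index_in P x) div 2" for z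
  have S: "index_in P x < index_in P z" "index_in P z \<le> index_in P y" "z \<in> P"
    "index_in P z mod 2 = index_in P x mod 2" if "z \<in> S" for z
  proof -
    show z: "z \<in> P" using that by (simp add: S_def residue_part_def)
    show "index_in P x < index_in P z"
      using that by (intro index_in_strict_mono[OF P(1) z]) (simp add: S_def)
    show "index_in P z \<le> index_in P y"
      using that by (intro index_in_mono[OF P(1)]) (simp add: S_def)
    show "index_in P z mod 2 = index_in P x mod 2"
      using that xy(1) by (simp add: S_def residue_part_def)
  qed
  have dbl: "index_in P z = index_in P x + 2 * f z" if "z \<in> S" for z
  proof -
    have "2 dvd index_in P z - index_in P x"
      using S(1,4)[OF that] mod_eq_dvd_iff_nat[of "index_in P x" "index_in P z" 2] by simp
    then show ?thesis unfolding f_def using S(1)[OF that] by simp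
  qed
  have "inj_on f S"
  proof (rule inj_onI)
    fix u v assume uv: "u \<in> S" "v \<in> S" "f u = f v"
    then have "index_in P u = index_in P v" using dbl by metis
    then show "u = v" using inj_onD[OF inj_on_index_in[OF P]] S(3) uv by blast
  qed
  moreover have "f ` S \<subseteq> {1..(index_in P y - index_in P x) div 2}"
  proof (rule image_subsetI)
    fix z assume z: "z \<in> S"
    have "1 \<le> f z" using dbl[OF z] S(1)[OF z] by linarith
    moreover have "f z \<le> (index_in P y - index_in P x) div 2"
      unfolding f_def using S(2)[OF z] by (intro div_le_mono diff_le_mono)
    ultimately show "f z \<in> {1..(index_in P y - index_in P x) div 2}" by simp
  qed
  ultimately have "card S \<le> card {1..(index_in P y - index_in P x) div 2}"
    by (rule card_inj_on_le) simp
  then show ?thesis unfolding cS by simp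
qed

lemma str_residue_part:
  assumes P: "finite P" "inj_on first_coord P" and C: "C \<subseteq> residue_part P a 2" "C \<noteq> {}"
  shows "2 * str (residue_part P a 2) C \<le> str P C"
proof -
  let ?R = "residue_part P a 2"
  have fin: "finite C" using C(1) residue_part_subset P(1) by (metis finite_subset)
  have "Max (index_in ?R ` C) \<in> index_in ?R ` C" using fin C(2) by (intro Max_in) auto
  then obtain y where y: "y \<in> C" "index_in ?R y = Max (index_in ?R ` C)"
    by (metis imageE)
  have "Min (index_in ?R ` C) \<in> index_in ?R ` C" using fin C(2) by (intro Min_in) auto
  then obtain x where x: "x \<in> C" "index_in ?R x = Min (index_in ?R ` C)"
    by (metis imageE)
  have "2 * str ?R C = 2 * (index_in ?R y - index_in ?R x)" by (simp add: str_def x(2) y(2))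
  also have "\<dots> \<le> index_in P y - index_in P x"
    using x y C(1) by (intro index_in_residue_part[OF P]) auto
  also have "\<dots> \<le> str P C" using fin x y by (intro index_in_diff_le_str)
  finally show ?thesis .
qed

text \<open>Indices depend on the order of first coordinates alone, which \<open>proj d\<close>
  preserves. So a stretch bound carries over unchanged to dimension \<open>d - 1\<close>.\<close>

lemma index_in_proj:
  assumes "regular d P" "d \<ge> 2"
  shows "index_in (proj d ` P) (proj d q) = index_in P q"
proof -
  have "{x \<in> proj d ` P. first_coord x \<le> first_coord (proj d q)}
      = proj d ` {x \<in> P. first_coord x \<le> first_coord q}"
    using assms(2) by (auto simp: first_coord_proj)
  moreover have "inj_on (proj d) {x \<in> P. first_coord x \<le> first_coord q}"
    by (rule inj_on_subset[OF inj_on_proj[OF assms]]) simp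
  ultimately show ?thesis unfolding index_in_def by (simp add: card_image)
qed

lemma str_proj:
  "regular d P \<Longrightarrow> d \<ge> 2 \<Longrightarrow> str (proj d ` P) (proj d ` C) = str P C"
  unfolding str_def image_image by (simp only: index_in_proj)

lemma proj_in_Rspace: "proj d x \<in> Rspace (d - 1)"
  unfolding Rspace_def by (auto simp: in_keys_iff lookup_proj split: if_splits)

lemma oscillator_proj:
  assumes "oscillator d P" "d \<ge> 2"
  shows "oscillator (d - 1) (proj d ` P)"
  using assms
proof cases
  case single
  then obtain p where "P = {p}" by (auto simp: card_1_singleton_iff)
  then show ?thesis using assms(2) proj_in_Rspace by (intro oscillator.single) auto
next
  case line
  then show ?thesis using assms(2) by simp
next
  case step
  then show ?thesis by simp
qed

lemma oscillator_finite: "oscillator d P \<Longrightarrow> finite P"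
proof (induction rule: oscillator.induct)
  case (single d P)
  then show ?case using card_ge_0_finite[of P] by simp
next
  case (step d P)
  show ?case using regularD(1)[OF step.hyps(3)] .
qed

lemma oscillator_dim_pos: "oscillator d P \<Longrightarrow> d \<ge> 1"
  by (induction rule: oscillator.induct) simp_all

lemma oscillator_subset: "oscillator d P \<Longrightarrow> P \<subseteq> Rspace d"
  by (induction rule: oscillator.induct) (simp_all add: regularD(2))

lemma oscillator_regular: "oscillator d P \<Longrightarrow> d \<ge> 2 \<Longrightarrow> card P \<ge> 2 \<Longrightarrow> regular d P"
  by (erule oscillator.cases) simp_all

subsection \<open>Size bounds\<close>

text \<open>The bound for a single cup or cap. For \<open>d = 1\<close> it reads
  \<open>0 ^ 0 = 1\<close>, so that its double matches the two points allowed on a line.\<close>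

definition size_bound :: "nat \<Rightarrow> real \<Rightarrow> real" where
  "size_bound d m = (4 * (real d - 1) * ln (2 * m)) ^ (d - 1)"

text \<open>The first two terms of the binomial expansion, proved like Bernoulli's
  inequality.\<close>

lemma power_Suc_add_ge:
  fixes x y :: real
  assumes "x \<ge> 0" "y \<ge> 0"
  shows "x ^ Suc n + real (Suc n) * x ^ n * y \<le> (x + y) ^ Suc n"
proof (induction n)
  case (Suc n)
  have "x ^ Suc (Suc n) + real (Suc (Suc n)) * x ^ Suc n * y
      \<le> x ^ Suc (Suc n) + real (Suc (Suc n)) * x ^ Suc n * y + real (Suc n) * x ^ n * y ^ 2"
    using assms by simp
  also have "\<dots> = (x ^ Suc n + real (Suc n) * x ^ n * y) * (x + y)"
    by (simp add: algebra_simps power2_eq_square)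
  also have "\<dots> \<le> (x + y) ^ Suc n * (x + y)"
    using Suc.IH assms by (intro mult_right_mono) auto
  also have "\<dots> = (x + y) ^ Suc (Suc n)" by (rule power_Suc2[symmetric])
  finally show ?case .
qed simp

lemma size_bound_nonneg: "d \<ge> 1 \<Longrightarrow> m \<ge> 1 \<Longrightarrow> 0 \<le> size_bound d m"
  unfolding size_bound_def by simp

text \<open>Halving \<open>m\<close> lowers the logarithm by \<open>ln 2\<close>, that is, the base
  from \<open>x + y\<close> to \<open>x\<close>. The linear term in \<open>y\<close> of the binomial
  expansion then pays for the lower-dimensional summand, which is at most
  \<open>2 * x ^ n\<close>.\<close>

lemma size_bound_step:
  assumes d: "d \<ge> 2" and m: "m \<ge> 2"
  shows "2 * size_bound (d - 1) (m / 2) + size_bound d (m / 2) \<le> size_bound d m"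
proof -
  define n where "n = d - 2"
  have n: "d = Suc (Suc n)" using d by (simp add: n_def)
  define L where "L = ln m"
  have L: "L \<ge> 0" using m by (simp add: L_def)
  define x where "x = 4 * real (Suc n) * L"
  define y where "y = 4 * real (Suc n) * ln 2"
  have x: "x \<ge> 0" using L by (simp add: x_def)
  have ln2: "ln 2 \<ge> (1 / 2 :: real)" using ln2_ge_two_thirds by simp
  \<comment> \<open>Here the factor 4 in \<open>size_bound\<close> matters: with
    \<open>ln 2 \<ge> 1 / 2\<close> it yields the 2 by which the lower-dimensional bound is
    multiplied.\<close>
  have y2: "y \<ge> 2"
  proof -
    have "4 * 1 * (1 / 2) \<le> y" unfolding y_def using ln2 by (intro mult_mono) auto
    then show ?thesis by simp
  qed
  have "size_bound (d - 1) (m / 2) = (4 * real n * L) ^ n"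
    using m by (simp add: size_bound_def n L_def)
  also have "\<dots> \<le> x ^ n"
    using L by (intro power_mono) (auto simp: x_def intro!: mult_right_mono)
  finally have 1: "size_bound (d - 1) (m / 2) \<le> x ^ n" .
  have "1 * x ^ n * 2 \<le> real (Suc n) * x ^ n * y"
    using x y2 by (intro mult_mono) auto
  moreover have "size_bound d (m / 2) = x ^ Suc n"
    using m by (simp add: size_bound_def n L_def x_def)
  moreover have "size_bound d m = (x + y) ^ Suc n"
  proof -
    have "ln (2 * m) = ln 2 + L" using m by (simp add: L_def ln_mult)
    then have "4 * (real d - 1) * ln (2 * m) = x + y" by (simp add: n x_def y_def algebra_simps)
    then show ?thesis by (simp add: size_bound_def n)
  qed
  ultimately show ?thesis
    using 1 power_Suc_add_ge[OF x, of y n] y2 by linarith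
qed

text \<open>It disposes of sets with at most \<open>d\<close> points. The base is at least
  \<open>2 * (d - 1) \<ge> d\<close>, and raising it to a positive power does not decrease
  it.\<close>

lemma dim_le_size_bound:
  assumes d: "d \<ge> 2" and m: "m \<ge> 1"
  shows "real d \<le> size_bound d m"
proof -
  define n where "n = real d - 1"
  have n: "n \<ge> 1" using d by (simp add: n_def)
  have "ln (2 * m) \<ge> ln 2" using m by simp
  then have "ln (2 * m) \<ge> 1 / 2" using ln2_ge_two_thirds by linarith
  then have x: "4 * n * ln (2 * m) \<ge> 4 * n * (1 / 2)" using n by (intro mult_left_mono) auto
  have one: "1 \<le> 4 * n * ln (2 * m)" using x n by linarith
  have "real d \<le> 4 * n * (1 / 2)" using n by (simp add: n_def)
  also have "\<dots> \<le> 4 * n * ln (2 * m)" by (rule x)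
  also have "\<dots> \<le> (4 * n * ln (2 * m)) ^ (d - 1)"
    using d one by (intro self_le_power) auto
  finally show ?thesis by (simp add: size_bound_def n_def)
qed

section \<open>The recursion on oscillators and dimension\<close>

text \<open>The dimension \<open>D\<close> is fixed and the induction descends to the two halves;
  \<open>lower\<close> stands for \<open>convexly_independent_card_bound\<close> one dimension down
  and is applied to projected halves.\<close>

lemma cup_cap_card_bound:
  assumes D: "D \<ge> 2"
    and lower: "\<And>P C m. oscillator (D - 1) P \<Longrightarrow> C \<subseteq> P \<Longrightarrow> C \<noteq> {} \<Longrightarrow> convexly_independent C \<Longrightarrow>
      1 \<le> m \<Longrightarrow> real (str P C) \<le> m \<Longrightarrow> real (card C) \<le> 2 * size_bound (D - 1) m"
  shows "oscillator d P \<Longrightarrow> d = D \<Longrightarrow> C \<subseteq> P \<Longrightarrow> C \<noteq> {} \<Longrightarrow> 1 \<le> m \<Longrightarrow> real (str P C) \<le> m \<Longrightarrow>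
      convex_cup D C \<or> convex_cap D C \<Longrightarrow> real (card C) \<le> size_bound D m"
proof (induction d P arbitrary: C m rule: oscillator.induct)
  case (single d P)
  have "card C \<le> 1"
    using card_mono[of P C] card_ge_0_finite[of P] single.hyps(3) single.prems(2) by simp
  then show ?case using dim_le_size_bound[OF D single.prems(4)] D by linarith
next
  case (line P)
  then show ?case using D by simp
next
  case (step d P)
  note d = \<open>d = D\<close>
  have reg: "regular D P" using step.hyps d by simp
  have P: "finite P" "inj_on first_coord P" using regularD(1)[OF reg] inj_on_first_coord[OF reg D] .
  have finC: "finite C" using finite_subset[OF step.prems(2) P(1)] .
  define A where "A = residue_part P 1 2"
  define B where "B = residue_part P 2 2"
  have AB: "A \<union> B = P" "A \<inter> B = {}"
    using residue_part_2_cover residue_part_2_disjoint by (auto simp: A_def B_def)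
  show ?case
  proof (cases "D < card C")
    case False
    then show ?thesis using dim_le_size_bound[OF D step.prems(4)] by linarith
  next
    case True
    \<comment> \<open>More than \<open>D \<ge> 2\<close> points force a stretch of at least 2, so
      \<open>m / 2 \<ge> 1\<close> is admissible in the recursive bounds.\<close>
    have "card C \<le> str P C + 1" using card_le_str[OF P step.prems(2)] .
    then have m: "m \<ge> 2" using True D step.prems(5) by linarith
    have half: "real (str (residue_part P a 2) (C \<inter> residue_part P a 2)) \<le> m / 2"
      if "C \<inter> residue_part P a 2 \<noteq> {}" for a
    proof -
      have "2 * str (residue_part P a 2) (C \<inter> residue_part P a 2) \<le> str P (C \<inter> residue_part P a 2)"
        using that by (intro str_residue_part[OF P]) auto
      also have "\<dots> \<le> str P C" using finC that by (intro str_mono) auto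
      finally show ?thesis using step.prems(5) by linarith
    qed
    have projected: "real (card (C \<inter> residue_part P a 2)) \<le> 2 * size_bound (D - 1) (m / 2)"
      if "C \<inter> residue_part P a 2 \<noteq> {}" "convexly_independent (proj D ` (C \<inter> residue_part P a 2))"
        "oscillator D (residue_part P a 2)" for a
    proof -
      let ?R = "residue_part P a 2"
      have R: "regular D ?R" using regular_subset[OF reg residue_part_subset] .
      have "card (proj D ` (C \<inter> ?R)) = card (C \<inter> ?R)"
        by (intro card_image inj_on_subset[OF inj_on_proj[OF R D]]) simp
      moreover have "real (card (proj D ` (C \<inter> ?R))) \<le> 2 * size_bound (D - 1) (m / 2)"
      proof (rule lower[OF oscillator_proj[OF that(3) D] _ _ that(2)])
        show "1 \<le> m / 2" using m by simp
        show "real (str (proj D ` ?R) (proj D ` (C \<inter> ?R))) \<le> m / 2"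
          using half[OF that(1)] by (simp add: str_proj[OF R D])
      qed (use that(1) in auto)
      ultimately show ?thesis by simp
    qed
    have sub: "convex_cup D (C \<inter> X) \<or> convex_cap D (C \<inter> X)" for X
      using step.prems(6) convex_cup_subset convex_cap_subset by (metis Int_lower1)
    have inA: "real (card (C \<inter> A)) \<le> size_bound D (m / 2)" if "C \<inter> A \<noteq> {}"
      using step.IH(1)[OF d, of "C \<inter> A" "m / 2"] that m half[of 1] sub[of A]
      unfolding A_def by simp
    have inB: "real (card (C \<inter> B)) \<le> size_bound D (m / 2)" if "C \<inter> B \<noteq> {}"
      using step.IH(2)[OF d, of "C \<inter> B" "m / 2"] that m half[of 2] sub[of B]
      unfolding B_def by simp
    have projA: "real (card (C \<inter> A)) \<le> 2 * size_bound (D - 1) (m / 2)"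
      if "C \<inter> A \<noteq> {}" "convexly_independent (proj D ` (C \<inter> A))"
      using projected[of 1] that step.hyps d unfolding A_def by simp
    have projB: "real (card (C \<inter> B)) \<le> 2 * size_bound (D - 1) (m / 2)"
      if "C \<inter> B \<noteq> {}" "convexly_independent (proj D ` (C \<inter> B))"
      using projected[of 2] that step.hyps d unfolding B_def by simp
    have C: "C = (C \<inter> A) \<union> (C \<inter> B)" using AB(1) step.prems(2) by auto
    have "card C = card (C \<inter> A) + card (C \<inter> B)"
      using finC AB(2) by (subst C, intro card_Un_disjoint) auto
    then have sum: "real (card C) = real (card (C \<inter> A)) + real (card (C \<inter> B))" by simp
    have nonneg: "0 \<le> size_bound (D - 1) (m / 2)" using D m by (intro size_bound_nonneg) auto
    have "real (card C) \<le> 2 * size_bound (D - 1) (m / 2) + size_bound D (m / 2)"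
    \<comment> \<open>If \<open>C\<close> lies in one half, the induction hypothesis for that half
      suffices. Otherwise one half is bounded through its projection and the other by
      induction.\<close>
    proof (cases "C \<inter> A = {} \<or> C \<inter> B = {}")
      case True
      then show ?thesis using sum inA inB nonneg C step.prems(3) by fastforce
    next
      case False
      then obtain a b where ab: "a \<in> C \<inter> A" "b \<in> C \<inter> B" by blast
      have BA: "B \<inter> A = {}" using AB(2) by blast
      have le: "D \<le> card C" using \<open>D < card C\<close> by simp
      have "high_above D A B \<or> high_above D B A" using step.hyps d by (simp add: A_def B_def)
      \<comment> \<open>For a cup it is the part in the higher half that projects independently, for
        a cap the part in the lower half; either half may be the higher one.\<close>
      then have "convexly_independent (proj D ` (C \<inter> A)) \<or> convexly_independent (proj D ` (C \<inter> B))"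
        using step.prems(6)
          cup_high_part_independent[OF _ D le _ AB(2) ab(2)] cup_high_part_independent[OF _ D le _ BA ab(1)]
          cap_low_part_independent[OF _ D le _ AB(2) ab(1)] cap_low_part_independent[OF _ D le _ BA ab(2)]
        by blast
      then show ?thesis using sum projA projB inA inB False by fastforce
    qed
    then show ?thesis using size_bound_step[OF D m] by linarith
  qed
qed

text \<open>Induction on the dimension, whose hypothesis is the assumption \<open>lower\<close> of
  \<open>cup_cap_card_bound\<close>. The factor 2 counts one cup and one cap.\<close>

lemma convexly_independent_card_bound:
  "oscillator d P \<Longrightarrow> C \<subseteq> P \<Longrightarrow> C \<noteq> {} \<Longrightarrow> convexly_independent C \<Longrightarrow> 1 \<le> m \<Longrightarrow>
    real (str P C) \<le> m \<Longrightarrow> real (card C) \<le> 2 * size_bound d m"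
proof (induction d arbitrary: P C m)
  case 0
  then show ?case using oscillator_dim_pos by fastforce
next
  case (Suc d)
  have finC: "finite C" using Suc.prems(1,2) oscillator_finite finite_subset by blast
  consider "d = 0" | "Suc d \<ge> 2" "card P < 2" | "Suc d \<ge> 2" "card P \<ge> 2" by linarith
  then show ?case
  proof cases
    case 1
    have "C \<subseteq> Rspace 1" using oscillator_subset[OF Suc.prems(1)] Suc.prems(2) 1 by simp
    then have "card C \<le> 2" by (rule convexly_independent_line[OF Suc.prems(4)])
    then show ?thesis using 1 by (simp add: size_bound_def)
  next
    case 2
    then have "card C \<le> 1"
      using card_mono[OF oscillator_finite[OF Suc.prems(1)] Suc.prems(2)] by linarith
    then show ?thesis using dim_le_size_bound[OF 2(1) Suc.prems(5)] by linarith
  next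
    case 3
    have reg: "regular (Suc d) C"
      using regular_subset[OF oscillator_regular[OF Suc.prems(1) 3] Suc.prems(2)] .
    obtain L U where C: "C = L \<union> U" and LU: "convex_cup (Suc d) L" "convex_cap (Suc d) U"
      using convexly_independent_cup_cap[OF Suc.prems(4) reg 3(1)] by blast
    have part: "real (card X) \<le> size_bound (Suc d) m"
      if X: "X \<subseteq> C" "convex_cup (Suc d) X \<or> convex_cap (Suc d) X" for X
    proof (cases "X = {}")
      case True
      then show ?thesis using size_bound_nonneg[of "Suc d" m] Suc.prems(5) by simp
    next
      case False
      have "str P X \<le> str P C" using str_mono[OF finC X(1) False] .
      then have "real (str P X) \<le> m"
        using Suc.prems(6) by linarith
      show ?thesis
      proof (rule cup_cap_card_bound[OF 3(1) _ Suc.prems(1) refl _ False Suc.prems(5) _ X(2)])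
        show "X \<subseteq> P" using X(1) Suc.prems(2) by (rule order_trans)
      qed (use Suc.IH \<open>real (str P X) \<le> m\<close> in simp_all)
    qed
    have "card C \<le> card L + card U" unfolding C by (rule card_Un_le)
    moreover have "real (card L) \<le> size_bound (Suc d) m" "real (card U) \<le> size_bound (Suc d) m"
      using part LU C by auto
    ultimately show ?thesis by linarith
  qed
qed

section \<open>From size bounds to stretch bounds\<close>

text \<open>This solves a size bound for \<open>m\<close> by taking the \<open>n\<close>-th root and
  exponentiating; it is applied with \<open>c = d - 1\<close> for cups and caps and with
  \<open>c = d\<close> for convexly independent sets.\<close>

lemma exp_root_le:
  fixes x c m :: real
  assumes x: "0 \<le> x" "x \<le> (4 * c * ln (2 * m)) ^ n" and n: "n \<ge> 1" and c: "c > 0" and m: "m \<ge> 1"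
  shows "1 / 2 * exp (x powr (1 / real n) / (4 * c)) \<le> m"
proof -
  have pos: "4 * c * ln (2 * m) > 0" using c m by simp
  have "x powr (1 / real n) \<le> ((4 * c * ln (2 * m)) ^ n) powr (1 / real n)"
    using x by (intro powr_mono2) auto
  also have "\<dots> = 4 * c * ln (2 * m)"
    using pos n by (simp add: powr_realpow[symmetric] powr_powr)
  finally have "x powr (1 / real n) / (4 * c) \<le> ln (2 * m)"
    using c by (simp add: field_simps)
  then have "exp (x powr (1 / real n) / (4 * c)) \<le> exp (ln (2 * m))" by simp
  also have "\<dots> = 2 * m" using m by simp
  finally show ?thesis by simp
qed

text \<open>With \<open>N = d - 1\<close>, Bernoulli gives
  \<open>2 * N ^ N \<le> (N + 1) ^ N\<close>. So the factor 2 is absorbed by replacing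
  \<open>4 * (d - 1)\<close> with \<open>4 * d\<close>, which is why the two final exponents
  differ.\<close>

lemma two_size_bound_le:
  assumes d: "d \<ge> 2" and m: "m \<ge> 1"
  shows "2 * size_bound d m \<le> (4 * real d * ln (2 * m)) ^ (d - 1)"
proof -
  define n where "n = d - 2"
  have n: "d = Suc (Suc n)" using d by (simp add: n_def)
  define L where "L = 4 * ln (2 * m)"
  have L: "L \<ge> 0" using m by (simp add: L_def)
  have "2 * real (Suc n) ^ Suc n \<le> (real (Suc n) + 1) ^ Suc n"
    using power_Suc_add_ge[of "real (Suc n)" 1 n] by simp
  then have "2 * real (Suc n) ^ Suc n * L ^ Suc n \<le> (real (Suc n) + 1) ^ Suc n * L ^ Suc n"
    using L by (intro mult_right_mono) auto
  also have "\<dots> = ((real (Suc n) + 1) * L) ^ Suc n" by (simp only: power_mult_distrib)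
  also have "2 * real (Suc n) ^ Suc n * L ^ Suc n = 2 * (real (Suc n) * L) ^ Suc n"
    by (simp only: power_mult_distrib mult.assoc)
  finally have "2 * (real (Suc n) * L) ^ Suc n \<le> ((real (Suc n) + 1) * L) ^ Suc n" .
  moreover have "4 * (real d - 1) * ln (2 * m) = real (Suc n) * L" by (simp add: n L_def)
  moreover have "4 * real d * ln (2 * m) = (real (Suc n) + 1) * L" by (simp add: n L_def)
  moreover have "d - 1 = Suc n" by (simp add: n)
  ultimately show ?thesis unfolding size_bound_def by (simp only:)
qed

text \<open>The values are natural numbers, so the real bound may be rounded up to \<open>N\<close>
  and compared inside \<open>enat\<close>, where an empty infimum is infinite.\<close>

lemma ereal_le_ereal_of_enat_INF:
  assumes "\<And>P C. P \<in> X \<Longrightarrow> C \<in> Y P \<Longrightarrow> r \<le> real (f P C)"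
  shows "ereal r \<le> ereal_of_enat (INF P\<in>X. INF C\<in>Y P. enat (f P C))"
proof -
  define N where "N = nat \<lceil>r\<rceil>"
  have "enat N \<le> (INF P\<in>X. INF C\<in>Y P. enat (f P C))"
  proof (intro INF_greatest)
    fix P C assume "P \<in> X" "C \<in> Y P"
    then have "r \<le> real (f P C)" using assms by blast
    then have "N \<le> f P C" unfolding N_def by linarith
    then show "enat N \<le> enat (f P C)" by simp
  qed
  then have "ereal_of_enat (enat N) \<le> ereal_of_enat (INF P\<in>X. INF C\<in>Y P. enat (f P C))"
    by (simp only: ereal_of_enat_le_iff)
  moreover have "ereal r \<le> ereal_of_enat (enat N)" unfolding N_def by (simp add: real_nat_ceiling_ge)
  ultimately show ?thesis by (rule order_trans[rotated])
qed

theorem theorem13: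
  fixes d k :: nat
  assumes "d \<ge> 2" and "k \<ge> 2"
  shows "ereal_of_enat (Delta' d k)
           \<ge> ereal (1 / 2 * exp (real k powr (1 / (real d - 1)) / (4 * real d - 4)))
       \<and> ereal_of_enat (Delta d k)
           \<ge> ereal (1 / 2 * exp (real k powr (1 / (real d - 1)) / (4 * real d)))"
proof -
  have d1: "real (d - 1) = real d - 1" using assms(1) by simp
  \<comment> \<open>Two points already give stretch at least 1, so the size bounds may be used with
    \<open>m\<close> equal to the stretch itself.\<close>
  have basic: "1 \<le> real (str P C) \<and> C \<noteq> {}"
    if P: "oscillator d P" and C: "C \<subseteq> P" "card C = k" for P C
  proof -
    have "card P \<ge> 2" using card_mono[OF oscillator_finite[OF P] C(1)] C(2) assms(2) by simp
    then have "regular d P" using oscillator_regular[OF P assms(1)] by simp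
    then have "card C \<le> str P C + 1"
      using card_le_str[OF regularD(1) inj_on_first_coord C(1)] assms(1) by blast
    then show ?thesis using C(2) assms(2) by auto
  qed
  have "1 / 2 * exp (real k powr (1 / (real d - 1)) / (4 * real d - 4)) \<le> real (str P C)"
    if P: "P \<in> {P. oscillator d P}" and C: "C \<in> cup_cap_subsets d k P" for P C
  proof -
    have C': "C \<subseteq> P" "card C = k" "convex_cup d C \<or> convex_cap d C"
      using C unfolding cup_cap_subsets_def by auto
    have s: "1 \<le> real (str P C)" "C \<noteq> {}" using basic[OF _ C'(1,2)] P by auto
    have "real (card C) \<le> size_bound d (real (str P C))"
      using P C' s by (intro cup_cap_card_bound[OF assms(1) convexly_independent_card_bound]) auto
    then have "1 / 2 * exp (real k powr (1 / real (d - 1)) / (4 * (real d - 1))) \<le> real (str P C)"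
      using assms C'(2) s by (intro exp_root_le) (auto simp: size_bound_def)
    then show ?thesis unfolding d1 by (simp add: right_diff_distrib)
  qed
  then have cup_cap: "ereal (1 / 2 * exp (real k powr (1 / (real d - 1)) / (4 * real d - 4)))
      \<le> ereal_of_enat (Delta' d k)"
    unfolding Delta'_def by (rule ereal_le_ereal_of_enat_INF)
  have "1 / 2 * exp (real k powr (1 / (real d - 1)) / (4 * real d)) \<le> real (str P C)"
    if P: "P \<in> {P. oscillator d P}" and C: "C \<in> convex_independent_subsets d k P" for P C
  proof -
    have C': "C \<subseteq> P" "card C = k" "convex_independent d C"
      using C unfolding convex_independent_subsets_def by auto
    have s: "1 \<le> real (str P C)" "C \<noteq> {}" using basic[OF _ C'(1,2)] P by auto
    have "real (card C) \<le> 2 * size_bound d (real (str P C))"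
      using P C' s by (intro convexly_independent_card_bound convex_independent_imp_convexly_independent) auto
    also have "\<dots> \<le> (4 * real d * ln (2 * real (str P C))) ^ (d - 1)"
      using two_size_bound_le assms(1) s(1) .
    finally have "1 / 2 * exp (real k powr (1 / real (d - 1)) / (4 * real d)) \<le> real (str P C)"
      using assms C'(2) s by (intro exp_root_le) auto
    then show ?thesis unfolding d1 .
  qed
  then have "ereal (1 / 2 * exp (real k powr (1 / (real d - 1)) / (4 * real d)))
      \<le> ereal_of_enat (Delta d k)"
    unfolding Delta_def by (rule ereal_le_ereal_of_enat_INF)
  with cup_cap show ?thesis ..
qed

end
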